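(* Let $E$ and $F$ be sequence functors (with index sets $\Gamma_E$ and $\Gamma_F$) and let $X$ be an infinite dimensional Banach space. If $$\bigcap_{p \in \Gamma_E}E(p,\mathbb{K}) - \bigcup_{q \in \Gamma_F}F(q,\mathbb{K}) \neq \emptyset,$$ then for every $p \in \Gamma_E$ the set $$\bigcap_{r \in \Gamma_E} E(r,X) - \bigcup_{q \in \Gamma_F}F(q,X)$$ is maximal spaceable in the topological vector space $E(p,X)$; i.e. its union with $\{0\}$ contains a closed linear subspace of $E(p,X)$ whose (algebraic) dimension equals $\dim E(p,X)$.
   Context: $\mathbb{K}=\mathbb{R}$ or $\mathbb{C}$; all linear spaces are over $\mathbb{K}$. For a Banach space $X$, $X^{\mathbb{N}}$ denotes the space of all $X$-valued sequences with coordinatewise operations. For subsets $A,B\subseteq X^{\mathbb{N}}$, $A-B := A\cap (X^{\mathbb{N}}\setminus B)$. For $a=(a_n)_{n}\in\mathbb{K}^{\mathbb{N}}$ and $x\in X$, $a\otimes x := (a_n x)_{n=1}^\infty\in X^{\mathbb{N}}$. A subset $A$ of a topological vector space $V$ is $\mu$-spaceable ($\mu$ a cardinal) if $A\cup\{0\}$ contains a closed $\mu$-dimensional linear subspace of $V$; it is maximal spaceable if it is $\dim V$-spaceable. Sequence functor: Let $\mathcal{B}$ be the class of all Banach spaces over $\mathbb{K}$. A sequence functor $E$ consists of a non-empty index set $\Gamma_E$ and an assignment to each $(p,X)\in\Gamma_E\times\mathcal{B}$ of a topological vector space $E(p,X)$ together with either a metric or a family of seminorms generating its topology, such that: (a)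 Exactly one of the following holds uniformly: (a1) for all $p\in\Gamma_E$ and $X\in\mathcal{B}$, $E(p,X)$ is metrizable and comes with a translation invariant metric $d_{E(p,X)}$ inducing its (linear) topology; or (a2) for all $p\in\Gamma_E$ and $X\in\mathcal{B}$, $E(p,X)$ is locally convex and comes with a family of seminorms inducing its topology. (b) For all $p\in\Gamma_E$ and $X\in\mathcal{B}$, $E(p,X)$ is a linear subspace of $X^{\mathbb{N}}$ (coordinatewise operations), and for all $a\in\mathbb{K}^{\mathbb{N}}$ and $x\in X$ with $x\neq 0$: $a\otimes x\in E(p,X)$ if and only if $a\in E(p,\mathbb{K})$. (c) For each $p\in\Gamma_E$ and each infinite dimensional $X\in\mathcal{B}$: (c1) in case (a1), there are constants $L_{X,p},M_{X,p}>0$ with $L_{X,p}\|x\|\,d_{E(p,\mathbb{K})}(a,0)\le d_{E(p,X)}(a\otimes x,0)\le M_{X,p}\|x\|\,d_{E(p,\mathbb{K})}(a,0)$ for all $a\in E(p,\mathbb{K})$, $x\in X$; (c2) in case (a2), there are a constant $K_{X,p}>0$ and a continuous seminorm $\alpha_{E(p,X)}$ from the given family such that $\|w_j\|_X\le K_{X,p}\,\alpha_{E(p,X)}(w)$ for all $w=(w_n)_n\in E(p,X)$ and all $j\in\mathbb{N}$. When $\Gamma_E$ is a singleton one writes simply $E(X)$. *)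

theory Defs
  imports "HOL-Analysis.Analysis" "HOL-Library.Equipollence" "HOL-Library.Function_Algebras"
begin

text \<open>The scalar field K is a type 'k of class real_normed_field (this is R or C up to
  isomorphism, by Mazur's theorem; both real and complex are instances).  A Banach space X
  over K is a (real) Banach space type 'x together with a K-scalar multiplication sc
  that extends the real one and is compatible with the norm.\<close>

definition kbanach :: "('k::{real_normed_field,banach} \<Rightarrow> 'x::banach \<Rightarrow> 'x) \<Rightarrow> bool" where
  "kbanach sc \<longleftrightarrow>
     (\<forall>x. sc 1 x = x) \<and>
     (\<forall>a b x. sc (a * b) x = sc a (sc b x)) \<and>
     (\<forall>a b x. sc (a + b) x = sc a x + sc b x) \<and>
     (\<forall>a x y. sc a (x + y) = sc a x + sc a y) \<and>
     (\<forall>a x. norm (sc a x) = norm a * norm x) \<and>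
     (\<forall>r x. sc (of_real r) x = r *\<^sub>R x)"

definition infinite_dim :: "('k::comm_ring_1 \<Rightarrow> 'x::ab_group_add \<Rightarrow> 'x) \<Rightarrow> bool" where
  "infinite_dim sc \<longleftrightarrow> \<not> (\<exists>B. finite B \<and> module.span sc B = UNIV)"

definition seq_scale :: "('k \<Rightarrow> 'x \<Rightarrow> 'x) \<Rightarrow> 'k \<Rightarrow> (nat \<Rightarrow> 'x) \<Rightarrow> (nat \<Rightarrow> 'x)" where
  "seq_scale sc c w = (\<lambda>n. sc c (w n))"

definition tensor :: "('k \<Rightarrow> 'x \<Rightarrow> 'x) \<Rightarrow> (nat \<Rightarrow> 'k) \<Rightarrow> 'x \<Rightarrow> (nat \<Rightarrow> 'x)" where
  "tensor sc a x = (\<lambda>n. sc (a n) x)"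

definition lin_subspace :: "('k \<Rightarrow> 'x::ab_group_add \<Rightarrow> 'x) \<Rightarrow> (nat \<Rightarrow> 'x) set \<Rightarrow> bool" where
  "lin_subspace sc E \<longleftrightarrow> 0 \<in> E \<and> (\<forall>v\<in>E. \<forall>w\<in>E. v + w \<in> E) \<and>
     (\<forall>c. \<forall>w\<in>E. seq_scale sc c w \<in> E)"

definition metric_on :: "'a set \<Rightarrow> ('a \<Rightarrow> 'a \<Rightarrow> real) \<Rightarrow> bool" where
  "metric_on S d \<longleftrightarrow>
     (\<forall>x\<in>S. \<forall>y\<in>S. 0 \<le> d x y \<and> (d x y = 0 \<longleftrightarrow> x = y) \<and> d x y = d y x) \<and>
     (\<forall>x\<in>S. \<forall>y\<in>S. \<forall>z\<in>S. d x z \<le> d x y + d y z)"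

definition translation_invariant :: "'a::ab_group_add set \<Rightarrow> ('a \<Rightarrow> 'a \<Rightarrow> real) \<Rightarrow> bool" where
  "translation_invariant S d \<longleftrightarrow> (\<forall>x\<in>S. \<forall>y\<in>S. \<forall>z\<in>S. d (x + z) (y + z) = d x y)"

definition metric_top :: "'a set \<Rightarrow> ('a \<Rightarrow> 'a \<Rightarrow> real) \<Rightarrow> 'a topology" where
  "metric_top S d = topology (\<lambda>U. U \<subseteq> S \<and>
     (\<forall>x\<in>U. \<exists>e>0. \<forall>y\<in>S. d x y < e \<longrightarrow> y \<in> U))"

definition seminorm_on :: "('k::real_normed_field \<Rightarrow> 'a::ab_group_add \<Rightarrow> 'a) \<Rightarrow> 'a set \<Rightarrow> ('a \<Rightarrow> real) \<Rightarrow> bool" where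
  "seminorm_on sc S \<sigma> \<longleftrightarrow>
     (\<forall>x\<in>S. 0 \<le> \<sigma> x) \<and>
     (\<forall>x\<in>S. \<forall>y\<in>S. \<sigma> (x + y) \<le> \<sigma> x + \<sigma> y) \<and>
     (\<forall>c. \<forall>x\<in>S. \<sigma> (sc c x) = norm c * \<sigma> x)"

definition seminorm_top :: "'a::ab_group_add set \<Rightarrow> ('i \<Rightarrow> 'a \<Rightarrow> real) \<Rightarrow> 'a topology" where
  "seminorm_top S \<sigma> = topology (\<lambda>U. U \<subseteq> S \<and>
     (\<forall>x\<in>U. \<exists>I e. finite I \<and> e > 0 \<and> {y\<in>S. \<forall>i\<in>I. \<sigma> i (y - x) < e} \<subseteq> U))"

definition linear_top :: "('k::real_normed_field \<Rightarrow> 'a::ab_group_add \<Rightarrow> 'a) \<Rightarrow> 'a set \<Rightarrow> 'a topology \<Rightarrow> bool" where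
  "linear_top sc E T \<longleftrightarrow> topspace T = E \<and>
     continuous_map (prod_topology T T) T (\<lambda>(v, w). v + w) \<and>
     continuous_map (prod_topology (euclidean :: 'k topology) T) T (\<lambda>(c, w). sc c w)"

text \<open>The data of a sequence functor E, evaluated at the two Banach spaces K and X:
  index set G; a flag m (True: case (a1), metrics; False: case (a2), seminorms);
  EK p = E(p,K), dK p its metric, sK p its seminorm family; likewise EXs p = E(p,X).\<close>

definition functor_top_K ::
  "bool \<Rightarrow> (nat \<Rightarrow> 'k) set \<Rightarrow> ((nat \<Rightarrow> 'k) \<Rightarrow> (nat \<Rightarrow> 'k) \<Rightarrow> real) \<Rightarrow>
   ('s \<Rightarrow> (nat \<Rightarrow> 'k::ab_group_add) \<Rightarrow> real) \<Rightarrow> (nat \<Rightarrow> 'k) topology" where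
  "functor_top_K m E d \<sigma> = (if m then metric_top E d else seminorm_top E \<sigma>)"

definition seq_functor ::
  "('k::{real_normed_field,banach} \<Rightarrow> 'x::banach \<Rightarrow> 'x) \<Rightarrow> 'p set \<Rightarrow> bool \<Rightarrow>
   ('p \<Rightarrow> (nat \<Rightarrow> 'k) set) \<Rightarrow> ('p \<Rightarrow> (nat \<Rightarrow> 'k) \<Rightarrow> (nat \<Rightarrow> 'k) \<Rightarrow> real) \<Rightarrow>
   ('p \<Rightarrow> 's \<Rightarrow> (nat \<Rightarrow> 'k) \<Rightarrow> real) \<Rightarrow>
   ('p \<Rightarrow> (nat \<Rightarrow> 'x) set) \<Rightarrow> ('p \<Rightarrow> (nat \<Rightarrow> 'x) \<Rightarrow> (nat \<Rightarrow> 'x) \<Rightarrow> real) \<Rightarrow>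
   ('p \<Rightarrow> 't \<Rightarrow> (nat \<Rightarrow> 'x) \<Rightarrow> real) \<Rightarrow> bool" where
  "seq_functor sc G m EK dK sK EXs dX sX \<longleftrightarrow>
     G \<noteq> {} \<and>
     (\<forall>p\<in>G.
        \<comment> \<open>(a) topological vector space structure, uniformly metric or uniformly seminormed\<close>
        (if m then
           metric_on (EK p) (dK p) \<and> translation_invariant (EK p) (dK p) \<and>
           metric_on (EXs p) (dX p) \<and> translation_invariant (EXs p) (dX p)
         else
           (\<forall>i. seminorm_on (seq_scale times) (EK p) (sK p i)) \<and>
           (\<forall>i. seminorm_on (seq_scale sc) (EXs p) (sX p i))) \<and>
        linear_top (seq_scale times) (EK p) (functor_top_K m (EK p) (dK p) (sK p)) \<and>
        linear_top (seq_scale sc) (EXs p) (functor_top_K m (EXs p) (dX p) (sX p)) \<and>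
        \<comment> \<open>(b)\<close>
        lin_subspace times (EK p) \<and> lin_subspace sc (EXs p) \<and>
        (\<forall>a x. x \<noteq> 0 \<longrightarrow> (tensor sc a x \<in> EXs p \<longleftrightarrow> a \<in> EK p)) \<and>
        \<comment> \<open>(c), for X infinite dimensional\<close>
        (infinite_dim sc \<longrightarrow>
          (if m then
             (\<exists>L M. L > 0 \<and> M > 0 \<and> (\<forall>a\<in>EK p. \<forall>x.
                L * norm x * dK p a 0 \<le> dX p (tensor sc a x) 0 \<and>
                dX p (tensor sc a x) 0 \<le> M * norm x * dK p a 0))
           else
             (\<exists>K i. K > 0 \<and> (\<forall>w\<in>EXs p. \<forall>j. norm (w j) \<le> K * sX p i w)))))"

definition hamel_basis :: "('k::comm_ring_1 \<Rightarrow> 'a::ab_group_add \<Rightarrow> 'a) \<Rightarrow> 'a set \<Rightarrow> 'a set \<Rightarrow> bool" where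
  "hamel_basis sc B W \<longleftrightarrow> B \<subseteq> W \<and> \<not> module.dependent sc B \<and> module.span sc B = W"

definition maximal_spaceable ::
  "('k::comm_ring_1 \<Rightarrow> 'a::ab_group_add \<Rightarrow> 'a) \<Rightarrow> 'a set \<Rightarrow> 'a topology \<Rightarrow> 'a set \<Rightarrow> bool" where
  "maximal_spaceable sc V T A \<longleftrightarrow>
     (\<exists>W. W \<subseteq> A \<union> {0} \<and> W \<subseteq> V \<and> module.subspace sc W \<and> closedin T W \<and>
        (\<exists>B C. hamel_basis sc B W \<and> hamel_basis sc C V \<and> B \<approx> C))"

end

theory Submission
  imports Defs
begin

text \<open>
  Fix a scalar sequence \<open>a\<close> that lies in every \<open>E(p,K)\<close> and in no \<open>F(q,K)\<close>. The witnessing subspace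
  is \<open>W = {a \<otimes> x | x}\<close>, a linear copy of \<open>X\<close>; it avoids all \<open>F(q,X)\<close> outside 0, and condition (c)
  together with completeness of \<open>X\<close> makes it closed.

  Maximality of its dimension amounts to \<open>dim X = |X^N|\<close>. A maximal 1/2-separated subset \<open>S\<close> of
  the unit ball has dense span by Riesz's lemma, so \<open>|X| \<le> |S^N|\<close>; conversely
  \<open>s \<mapsto> \<Sum>n. 8^-n s_n\<close> embeds \<open>S^N\<close> into \<open>X\<close>, so \<open>|X^N| = |X|\<close>. Finally \<open>dim X \<ge> |K|\<close>, which
  yields \<open>dim X = |X|\<close>: if \<open>x_n\<close> has distance at least 1/2 from the span of its predecessors,
  then the vectors \<open>v_l = \<Sum>n. l^n 2^-(n^3) x_n\<close> for \<open>0 < |l| \<le> 1\<close> are linearly independent, because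
  a linear relation among them would make an exponential sum \<open>\<Sum>l. \<mu>_l l^n\<close> decay
  faster than any geometric sequence. This argument needs no classification of the field \<open>K\<close>.
\<close>

subsection \<open>Cardinalities of lists, sequences and spans\<close>

lemma infinite_times_self_lepoll:
  assumes "infinite A"
  shows "A \<times> A \<lesssim> A"
  using card_of_Times_same_infinite[OF assms] unfolding eqpoll_iff_card_of_ordIso[symmetric]
  by (rule eqpoll_imp_lepoll)

text \<open>Folding an injection \<open>h\<close> of pairs, seeded with an arbitrary
  \<open>z\<close>, codes a list by one element of \<open>A\<close>. The code is injective only
  among lists of equal length, so the length is recorded as well; it is absorbed because
  \<open>A\<close> is infinite.\<close>

lemma infinite_lists_lepoll:
  assumes "infinite A"
  shows "lists A \<lesssim> A"
proof -
  obtain h where h: "inj_on h (A \<times> A)" "h ` (A \<times> A) \<subseteq> A"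
    using infinite_times_self_lepoll[OF assms] by (auto simp: lepoll_def)
  obtain z where z: "z \<in> A"
    using assms by fastforce
  define enc where "enc = (\<lambda>xs. foldr (\<lambda>x y. h (x, y)) xs z)"
  have enc_mem: "enc xs \<in> A" if "xs \<in> lists A" for xs
    using that z h(2) by (induction xs) (auto simp: enc_def)
  have enc_inj: "xs = ys" if "length xs = length ys" "xs \<in> lists A" "ys \<in> lists A" "enc xs = enc ys" for xs ys
    using that
  proof (induction xs ys rule: list_induct2)
    case (Cons x xs y ys)
    have "h (x, enc xs) = h (y, enc ys)"
      using Cons.prems by (simp add: enc_def)
    then have "(x, enc xs) = (y, enc ys)"
      using Cons.prems enc_mem by (intro inj_onD[OF h(1)]) auto
    with Cons show ?case
      by auto
  qed simp
  have "inj_on (\<lambda>xs. (length xs, enc xs)) (lists A)"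
    using enc_inj by (auto simp: inj_on_def)
  moreover have "(\<lambda>xs. (length xs, enc xs)) ` lists A \<subseteq> UNIV \<times> A"
    using enc_mem by blast
  ultimately have "lists A \<lesssim> (UNIV :: nat set) \<times> A"
    unfolding lepoll_def by blast
  also have "\<dots> \<lesssim> A \<times> A"
    using assms by (intro times_lepoll_mono) (auto simp: infinite_le_lepoll)
  also have "\<dots> \<lesssim> A"
    by (rule infinite_times_self_lepoll[OF assms])
  finally show ?thesis .
qed

text \<open>A sequence of sequences is a function of two indices, and the pairing bijection on the
  naturals merges these into one.\<close>

lemma funcset_nat_nat_lepoll:
  "(UNIV :: nat set) \<rightarrow>\<^sub>E ((UNIV :: nat set) \<rightarrow>\<^sub>E S) \<lesssim> (UNIV :: nat set) \<rightarrow>\<^sub>E S"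
proof -
  let ?f = "\<lambda>(F :: nat \<Rightarrow> nat \<Rightarrow> 'a) n. F (fst (prod_decode n)) (snd (prod_decode n))"
  have "inj ?f"
  proof (rule injI, intro ext)
    fix F G :: "nat \<Rightarrow> nat \<Rightarrow> 'a" and i j
    assume "?f F = ?f G"
    from fun_cong[OF this, of "prod_encode (i, j)"] show "F i j = G i j"
      by simp
  qed
  moreover have "?f ` (UNIV \<rightarrow>\<^sub>E (UNIV \<rightarrow>\<^sub>E S)) \<subseteq> UNIV \<rightarrow>\<^sub>E S"
    by (auto simp: PiE_iff)
  ultimately show ?thesis
    unfolding lepoll_def by (meson inj_on_subset subset_UNIV)
qed

text \<open>Two distinct values \<open>s\<close> and \<open>t\<close> suffice to write down
  characteristic functions of sets of naturals.\<close>

lemma reals_lepoll_funcset: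
  assumes "s \<in> S" "t \<in> S" "s \<noteq> t"
  shows "(UNIV :: real set) \<lesssim> (UNIV :: nat set) \<rightarrow>\<^sub>E S"
proof -
  have "(UNIV :: real set) \<lesssim> (UNIV :: nat set set)"
    by (rule eqpoll_imp_lepoll[OF eqpoll_sym[OF nat_sets_eqpoll_reals]])
  also have "\<dots> \<lesssim> (UNIV :: nat set) \<rightarrow>\<^sub>E S"
    unfolding lepoll_def
  proof (intro exI conjI)
    show "inj (\<lambda>N n. if n \<in> N then s else t)"
      using assms(3) by (auto simp: inj_def fun_eq_iff split: if_splits)
  qed (use assms in auto)
  finally show ?thesis .
qed

context vector_space
begin

text \<open>Evaluating lists of (coefficient, vector) pairs as linear combinations covers the whole
  span, and a surjection is enough for \<open>\<lesssim>\<close>.\<close>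

lemma span_lepoll_lists: "span B \<lesssim> lists ((UNIV :: 'a set) \<times> B)"
proof (rule subset_image_lepoll, rule subsetI)
  fix y assume "y \<in> span B"
  then obtain t r where t: "finite t" "t \<subseteq> B" "y = (\<Sum>a\<in>t. r a *s a)"
    by (auto simp: span_explicit)
  obtain l where l: "distinct l" "set l = t"
    using finite_distinct_list[OF t(1)] by blast
  have "y = (\<Sum>(c, b)\<leftarrow>map (\<lambda>a. (r a, a)) l. c *s b)"
    using l t(3) by (simp add: sum_list_distinct_conv_sum_set o_def)
  moreover have "map (\<lambda>a. (r a, a)) l \<in> lists (UNIV \<times> B)"
    using l t by auto
  ultimately show "y \<in> (\<lambda>xs. \<Sum>(c, b)\<leftarrow>xs. c *s b) ` lists (UNIV \<times> B)"
    by blast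
qed

lemma span_lepoll:
  assumes "infinite B" "(UNIV :: 'a set) \<lesssim> B"
  shows "span B \<lesssim> B"
proof -
  have "(UNIV :: 'a set) \<times> B \<lesssim> B \<times> B"
    using assms(2) by (intro times_lepoll_mono) auto
  also have "\<dots> \<lesssim> B"
    by (rule infinite_times_self_lepoll[OF assms(1)])
  finally have *: "lists ((UNIV :: 'a set) \<times> B) \<lesssim> lists B"
    by (rule lists_lepoll_mono)
  show ?thesis
    by (rule lepoll_trans[OF span_lepoll_lists lepoll_trans[OF * infinite_lists_lepoll[OF assms(1)]]])
qed

end

subsection \<open>Riesz's lemma and finitely generated subspaces\<close>

text \<open>Choose \<open>m0\<close> in \<open>M\<close> with distance \<open>r < 2 * d\<close> from
  a point \<open>x0\<close> outside \<open>M\<close>, where \<open>d\<close> is the distance of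
  \<open>x0\<close> from \<open>M\<close>, and normalise \<open>x0 - m0\<close>. Division by
  \<open>r\<close> turns the distance \<open>d\<close> into \<open>d / r\<close>, which exceeds
  1/2.\<close>

lemma riesz_lemma_half:
  fixes M :: "'x::real_normed_vector set"
  assumes "subspace M" "closed M" "M \<noteq> UNIV"
  obtains x where "norm x \<le> 1" "\<And>m. m \<in> M \<Longrightarrow> 1/2 \<le> norm (x - m)"
proof -
  obtain x0 where x0: "x0 \<notin> M"
    using assms(3) by blast
  have M0: "M \<noteq> {}"
    using subspace_0[OF assms(1)] by blast
  define d where "d = infdist x0 M"
  have d: "d > 0"
    unfolding d_def using infdist_pos_not_in_closed[OF assms(2) M0 x0] .
  have "infdist x0 M < 2 * d"
    using d by (simp add: d_def)
  then obtain m0 where m0: "m0 \<in> M" "dist x0 m0 < 2 * d"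
    using M0 cINF_less_iff[OF M0 bdd_below_image_dist] by (auto simp: infdist_notempty)
  define r where "r = norm (x0 - m0)"
  have r: "0 < r" "r < 2 * d"
    using m0 x0 by (auto simp: r_def dist_norm)
  show ?thesis
  proof
    show "norm ((1/r) *\<^sub>R (x0 - m0)) \<le> 1"
      using r by (simp add: r_def)
    fix m assume "m \<in> M"
    then have "m0 + r *\<^sub>R m \<in> M"
      using assms(1) m0(1) by (simp add: subspace_add subspace_scale)
    then have "d \<le> dist x0 (m0 + r *\<^sub>R m)"
      unfolding d_def by (rule infdist_le)
    also have "x0 - (m0 + r *\<^sub>R m) = r *\<^sub>R ((1/r) *\<^sub>R (x0 - m0) - m)"
      using r by (simp add: algebra_simps)
    then have "dist x0 (m0 + r *\<^sub>R m) = r * norm ((1/r) *\<^sub>R (x0 - m0) - m)"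
      using r by (simp add: dist_norm)
    finally have "d \<le> r * norm ((1/r) *\<^sub>R (x0 - m0) - m)" .
    then have "d / r \<le> norm ((1/r) *\<^sub>R (x0 - m0) - m)"
      using r by (simp add: field_simps)
    moreover have "1/2 \<le> d / r"
      using r by (simp add: field_simps)
    ultimately show "1/2 \<le> norm ((1/r) *\<^sub>R (x0 - m0) - m)"
      by linarith
  qed
qed

locale kbanach_space =
  fixes sc :: "'k::{real_normed_field,banach} \<Rightarrow> 'x::banach \<Rightarrow> 'x"
  assumes kbanach: "kbanach sc"
begin

sublocale vector_space sc
  using kbanach by unfold_locales (auto simp: kbanach_def)

lemma norm_scale: "norm (sc c x) = norm c * norm x"
  using kbanach by (simp add: kbanach_def)

lemma scale_of_real: "sc (of_real r) x = r *\<^sub>R x"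
  using kbanach by (simp add: kbanach_def)

sublocale scale: bounded_bilinear sc
proof
  show "\<exists>K. \<forall>a b. norm (sc a b) \<le> norm a * norm b * K"
    by (intro exI[of _ 1]) (simp add: norm_scale)
  show "sc (r *\<^sub>R a) b = r *\<^sub>R sc a b" for r a b
    by (metis scale_of_real scale_scale scaleR_conv_of_real)
  show "sc a (r *\<^sub>R b) = r *\<^sub>R sc a b" for r a b
    by (metis scale_of_real scale_scale mult.commute)
qed (simp_all add: scale_left_distrib scale_right_distrib)

lemma real_subspace_if_subspace: "subspace V \<Longrightarrow> Real_Vector_Spaces.subspace V"
  by (auto simp: Real_Vector_Spaces.subspace_def subspace_def simp flip: scale_of_real)

text \<open>The positive distance \<open>d\<close> from \<open>b\<close> to \<open>span B\<close>
  controls the coefficient of \<open>b\<close>. Along a convergent sequence these coefficients are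
  therefore Cauchy and converge in the complete field; what remains converges inside the closed
  \<open>span B\<close>.\<close>

lemma closed_span_insert:
  assumes "closed (span B)"
  shows "closed (span (insert b B))"
proof (cases "b \<in> span B")
  case True
  then show ?thesis
    using assms by (simp add: span_redundant)
next
  case False
  define d where "d = infdist b (span B)"
  have "span B \<noteq> {}"
    using span_zero by blast
  then have d: "d > 0"
    unfolding d_def using infdist_pos_not_in_closed[OF assms _ False] by blast
  have bound: "norm c * d \<le> norm (m + sc c b)" if m: "m \<in> span B" for c m
  proof (cases "c = 0")
    case False
    have "sc (- inverse c) m \<in> span B"
      using m by (rule span_scale)
    then have "d \<le> dist b (sc (- inverse c) m)"
      unfolding d_def by (rule infdist_le)
    then have "norm c * d \<le> norm c * norm (b - sc (- inverse c) m)"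
      by (simp add: dist_norm mult_left_mono)
    also have "\<dots> = norm (sc c (b - sc (- inverse c) m))"
      by (simp add: norm_scale)
    also have "sc c (b - sc (- inverse c) m) = m + sc c b"
      using False by (simp add: scale_right_distrib)
    finally show ?thesis .
  qed simp
  show ?thesis
    unfolding closed_sequential_limits
  proof (intro allI impI, elim conjE)
    fix Y y
    assume ymem: "\<forall>n. Y n \<in> span (insert b B)" and lim: "Y \<longlonglongrightarrow> y"
    show "y \<in> span (insert b B)"
    proof -
      obtain c where c: "\<And>n. Y n - sc (c n) b \<in> span B"
        using ymem unfolding span_breakdown_eq by metis
      have le: "norm (c m - c n) * d \<le> norm (Y m - Y n)" for m n
        using bound[OF span_diff[OF c[of m] c[of n]], of "c m - c n"]
        by (simp add: scale_left_diff_distrib algebra_simps)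
      have "Cauchy Y"
        using lim by (rule LIMSEQ_imp_Cauchy)
      have "Cauchy c"
      proof (rule CauchyI)
        fix e :: real assume "e > 0"
        then obtain N where N: "\<forall>m\<ge>N. \<forall>n\<ge>N. norm (Y m - Y n) < e * d"
          using CauchyD[OF \<open>Cauchy Y\<close>, of "e * d"] d by auto
        have "norm (c m - c n) < e" if "m \<ge> N" "n \<ge> N" for m n
        proof -
          have "norm (c m - c n) * d < e * d"
            using le[of m n] N that by fastforce
          then show ?thesis
            using d by simp
        qed
        then show "\<exists>M. \<forall>m\<ge>M. \<forall>n\<ge>M. norm (c m - c n) < e"
          by blast
      qed
      then obtain c0 where "c \<longlonglongrightarrow> c0"
        using Cauchy_convergent_iff convergent_def by blast
      then have *: "(\<lambda>n. Y n - sc (c n) b) \<longlonglongrightarrow> y - sc c0 b"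
        by (intro tendsto_diff lim scale.tendsto tendsto_const)
      have "y - sc c0 b \<in> span B"
        by (rule closed_sequentially[OF assms c *])
      then show ?thesis
        unfolding span_breakdown_eq by blast
    qed
  qed
qed

lemma closed_span_finite: "finite B \<Longrightarrow> closed (span B)"
  by (induction B rule: finite_induct) (auto intro: closed_span_insert)

end

subsection \<open>Sequences in a Banach space\<close>

text \<open>Makes the results of the locale available over the reals, in particular the closedness
  of finitely generated real subspaces.\<close>

lemma kbanach_scaleR: "kbanach (scaleR :: real \<Rightarrow> 'x::banach \<Rightarrow> 'x)"
  by (simp add: kbanach_def scaleR_add_left scaleR_add_right)

lemma subspace_closure:
  fixes M :: "'x::real_normed_vector set"
  assumes "subspace M"
  shows "subspace (closure M)"
  unfolding subspace_def
proof (intro conjI ballI allI)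
  show "0 \<in> closure M"
    using subspace_0[OF assms] closure_subset by blast
next
  fix x y assume "x \<in> closure M" "y \<in> closure M"
  then obtain u v where "\<forall>n. u n \<in> M" "u \<longlonglongrightarrow> x" "\<forall>n. v n \<in> M" "v \<longlonglongrightarrow> y"
    unfolding closure_sequential by blast
  then have "\<forall>n. u n + v n \<in> M" "(\<lambda>n. u n + v n) \<longlonglongrightarrow> x + y"
    using subspace_add[OF assms] by (auto intro: tendsto_add)
  then show "x + y \<in> closure M"
    unfolding closure_sequential by (intro exI[of _ "\<lambda>n. u n + v n"] conjI)
next
  fix c x assume "x \<in> closure M"
  then obtain u where "\<forall>n. u n \<in> M" "u \<longlonglongrightarrow> x"
    unfolding closure_sequential by blast
  then have "\<forall>n. c *\<^sub>R u n \<in> M" "(\<lambda>n. c *\<^sub>R u n) \<longlonglongrightarrow> c *\<^sub>R x"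
    using subspace_scale[OF assms] by (auto intro: tendsto_intros)
  then show "c *\<^sub>R x \<in> closure M"
    unfolding closure_sequential by (intro exI[of _ "\<lambda>n. c *\<^sub>R u n"] conjI)
qed

text \<open>Zorn's lemma yields a maximal separated set. If its span were not dense, Riesz's lemma
  applied to the closure of the span would give a further point that could be added.\<close>

lemma maximal_separated_dense_span:
  obtains S :: "'x::banach set" where "S \<subseteq> cball 0 1"
    "\<And>x y. x \<in> S \<Longrightarrow> y \<in> S \<Longrightarrow> x \<noteq> y \<Longrightarrow> 1/2 \<le> norm (x - y)"
    "closure (span S) = UNIV"
proof -
  define A where "A = {S :: 'x set. S \<subseteq> cball 0 1 \<and> (\<forall>x\<in>S. \<forall>y\<in>S. x \<noteq> y \<longrightarrow> 1/2 \<le> norm (x - y))}"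
  have "\<exists>S\<in>A. \<forall>X\<in>A. S \<subseteq> X \<longrightarrow> X = S"
  proof (rule subset_Zorn')
    fix C assume C: "subset.chain A C"
    have "1/2 \<le> norm (x - y)" if xy: "x \<in> \<Union>C" "y \<in> \<Union>C" "x \<noteq> y" for x y
    proof -
      obtain P Q where "P \<in> C" "x \<in> P" "Q \<in> C" "y \<in> Q"
        using xy by blast
      moreover from this have "P \<subseteq> Q \<or> Q \<subseteq> P"
        using C by (auto simp: subset_chain_def)
      moreover have "P \<in> A" "Q \<in> A"
        using calculation C by (auto simp: subset_chain_def)
      ultimately show ?thesis
        using xy(3) by (auto simp: A_def)
    qed
    moreover have "\<Union>C \<subseteq> cball 0 1"
      using C by (fastforce simp: subset_chain_def A_def)
    ultimately show "\<Union>C \<in> A"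
      by (simp add: A_def)
  qed
  then obtain S where S: "S \<in> A" and max: "\<And>X. X \<in> A \<Longrightarrow> S \<subseteq> X \<Longrightarrow> X = S"
    by blast
  have "closure (span S) = UNIV"
  proof (rule ccontr)
    assume "closure (span S) \<noteq> UNIV"
    then obtain x where x: "norm x \<le> 1" "\<And>m. m \<in> closure (span S) \<Longrightarrow> 1/2 \<le> norm (x - m)"
      using riesz_lemma_half[OF subspace_closure[OF subspace_span] closed_closure] by blast
    have *: "1/2 \<le> norm (x - m)" if "m \<in> S" for m
      using that x(2) closure_subset span_base by blast
    then have "x \<notin> S"
      by force
    moreover have "insert x S \<in> A"
      using S x(1) * by (auto simp: A_def norm_minus_commute)
    ultimately show False
      using max by blast
  qed
  with S that show ?thesis
    by (auto simp: A_def)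
qed

text \<open>The series \<Sum>n. 8^-n s_n determines \<open>s\<close>: at the first index
  \<open>N\<close> where two sequences differ, the terms differ in norm by at least (1/2) 8^-N,
  while all later terms together contribute at most (2/7) 8^-N.\<close>

lemma separated_sequences_lepoll:
  fixes S :: "'x::banach set"
  assumes ball: "S \<subseteq> cball 0 1"
    and sep: "\<And>x y. x \<in> S \<Longrightarrow> y \<in> S \<Longrightarrow> x \<noteq> y \<Longrightarrow> 1/2 \<le> norm (x - y)"
  shows "(UNIV :: nat set) \<rightarrow>\<^sub>E S \<lesssim> (UNIV :: 'x set)"
proof -
  define f where "f = (\<lambda>(s :: nat \<Rightarrow> 'x) n. (1/8) ^ n *\<^sub>R s n)"
  have geo: "summable (\<lambda>n. c * (1/8::real) ^ n)" for c
    by (simp add: summable_geometric)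
  have summ: "summable (f s)" if "s \<in> UNIV \<rightarrow>\<^sub>E S" for s
  proof (rule summable_comparison_test'[OF geo[of 1]])
    fix n
    have "norm (s n) \<le> 1"
      using that ball by (force simp: PiE_iff)
    then show "norm (f s n) \<le> 1 * (1/8) ^ n"
      by (simp add: f_def mult_left_le)
  qed
  have "inj_on (\<lambda>s. suminf (f s)) (UNIV \<rightarrow>\<^sub>E S)"
  proof (rule inj_onI, rule ccontr)
    fix s t assume s: "s \<in> UNIV \<rightarrow>\<^sub>E S" and t: "t \<in> UNIV \<rightarrow>\<^sub>E S"
      and eq: "suminf (f s) = suminf (f t)" and "s \<noteq> t"
    then obtain n0 where "s n0 \<noteq> t n0"
      by blast
    define N where "N = (LEAST n. s n \<noteq> t n)"
    have N: "s N \<noteq> t N"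
      unfolding N_def by (rule LeastI) fact
    have below: "s n = t n" if "n < N" for n
      using not_less_Least that unfolding N_def by blast
    define g where "g = (\<lambda>n. f s n - f t n)"
    have g: "summable g"
      unfolding g_def by (intro summable_diff summ s t)
    have "suminf g = 0"
      unfolding g_def using eq by (simp add: suminf_diff[symmetric] summ s t)
    moreover have "suminf g = (\<Sum>n. g (n + Suc N)) + (\<Sum>n<Suc N. g n)"
      by (rule suminf_split_initial_segment[OF g])
    moreover have "(\<Sum>n<Suc N. g n) = g N"
      using below by (simp add: g_def f_def)
    ultimately have "norm (g N) = norm (\<Sum>n. g (n + Suc N))"
      by (metis norm_minus_cancel add_eq_0_iff)
    also have "\<dots> \<le> (\<Sum>n. (2 * (1/8) ^ Suc N) * (1/8) ^ n)"
    proof (rule norm_suminf_le[OF _ geo])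
      fix n
      have "norm (s (n + Suc N)) \<le> 1" "norm (t (n + Suc N)) \<le> 1"
        using s t ball by (force simp: PiE_iff)+
      then have "norm (s (n + Suc N) - t (n + Suc N)) \<le> 2"
        using norm_triangle_ineq4[of "s (n + Suc N)" "t (n + Suc N)"] by linarith
      then have "(1/8) ^ (n + Suc N) * norm (s (n + Suc N) - t (n + Suc N)) \<le> (1/8) ^ (n + Suc N) * 2"
        by (intro mult_left_mono) auto
      then show "norm (g (n + Suc N)) \<le> 2 * (1/8) ^ Suc N * (1/8) ^ n"
        by (simp add: g_def f_def power_add mult_ac flip: scaleR_diff_right)
    qed
    also have "\<dots> = (2/7) * (1/8) ^ N"
      by (subst suminf_mult) (simp_all add: summable_geometric suminf_geometric)
    finally have "norm (g N) \<le> (2/7) * (1/8) ^ N" .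
    moreover have "norm (g N) = (1/8) ^ N * norm (s N - t N)"
      by (simp add: g_def f_def flip: scaleR_diff_right)
    moreover have "(1/8) ^ N * (1/2) \<le> (1/8::real) ^ N * norm (s N - t N)"
      using s t N sep by (intro mult_left_mono) (auto simp: PiE_iff)
    moreover have "(0::real) < (1/8) ^ N"
      by simp
    ultimately show False
      by linarith
  qed
  then show ?thesis
    unfolding lepoll_def by blast
qed

text \<open>All cardinals are compared with \<open>T\<close>, the set of sequences in a maximal
  separated set \<open>S\<close>. The real span of \<open>S\<close> injects into \<open>T\<close>,
  hence so does \<open>X\<close>, whose points are limits of sequences from that span;
  \<open>T\<close> absorbs sequences and embeds into \<open>X\<close>.\<close>

lemma sequences_lepoll_banach:
  assumes inf: "\<not> (\<exists>B :: 'x::banach set. finite B \<and> span B = UNIV)"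
  shows "(UNIV :: (nat \<Rightarrow> 'x) set) \<lesssim> (UNIV :: 'x set)"
proof -
  obtain S :: "'x set" where S: "S \<subseteq> cball 0 1"
    "\<And>x y. x \<in> S \<Longrightarrow> y \<in> S \<Longrightarrow> x \<noteq> y \<Longrightarrow> 1/2 \<le> norm (x - y)"
    and dense: "closure (span S) = UNIV"
    using maximal_separated_dense_span by blast
  interpret R: kbanach_space "scaleR :: real \<Rightarrow> 'x \<Rightarrow> 'x"
    by (rule kbanach_space.intro, rule kbanach_scaleR)
  have span_eq: "module.span scaleR = (span :: 'x set \<Rightarrow> 'x set)"
    by (simp only: span_raw_def)
  \<comment> \<open>A finite \<open>S\<close> would have a span that is both closed and dense, hence
    all of the space.\<close>
  have "infinite S"
    using inf dense R.closed_span_finite[of S, unfolded span_eq] by auto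
  then obtain s where s: "s \<in> S"
    by fastforce
  obtain t where t: "t \<in> S" "s \<noteq> t"
    using \<open>infinite S\<close> by (metis finite.emptyI finite_insert finite_subset insertI1 subsetI)
  define T where "T = (UNIV :: nat set) \<rightarrow>\<^sub>E S"
  have "S \<lesssim> T"
    unfolding lepoll_def T_def by (intro exI[of _ "\<lambda>x _. x"]) (auto simp: inj_on_def fun_eq_iff)
  have "infinite T"
    using lepoll_trans[OF _ \<open>S \<lesssim> T\<close>] \<open>infinite S\<close> unfolding infinite_le_lepoll by blast
  have "(UNIV :: real set) \<times> S \<lesssim> T \<times> T"
    using \<open>S \<lesssim> T\<close> reals_lepoll_funcset[OF s t] unfolding T_def by (intro times_lepoll_mono)
  also have "\<dots> \<lesssim> T"
    by (rule infinite_times_self_lepoll[OF \<open>infinite T\<close>])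
  finally have "lists ((UNIV :: real set) \<times> S) \<lesssim> lists T"
    by (rule lists_lepoll_mono)
  also have "\<dots> \<lesssim> T"
    by (rule infinite_lists_lepoll[OF \<open>infinite T\<close>])
  finally have span_T: "span S \<lesssim> T"
    by (rule lepoll_trans[OF real_vector.span_lepoll_lists])
  have TT: "(UNIV :: nat set) \<rightarrow>\<^sub>E T \<lesssim> T"
    unfolding T_def by (rule funcset_nat_nat_lepoll)
  have "(UNIV :: 'x set) \<lesssim> (UNIV :: nat set) \<rightarrow>\<^sub>E span S"
  proof (rule subset_image_lepoll, rule subsetI)
    fix x :: 'x
    have "x \<in> closure (span S)"
      using dense by simp
    then obtain u where "\<forall>n. u n \<in> span S" "u \<longlonglongrightarrow> x"
      unfolding closure_sequential by blast
    then show "x \<in> lim ` (UNIV \<rightarrow>\<^sub>E span S)"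
      by (intro image_eqI[of _ _ u]) (auto simp: limI)
  qed
  also have "\<dots> \<lesssim> (UNIV :: nat set) \<rightarrow>\<^sub>E T"
    by (rule lepoll_funcset_right[OF span_T])
  also note TT
  finally have "(UNIV :: nat set) \<rightarrow>\<^sub>E (UNIV :: 'x set) \<lesssim> (UNIV :: nat set) \<rightarrow>\<^sub>E T"
    by (rule lepoll_funcset_right)
  also note TT
  also have "T \<lesssim> (UNIV :: 'x set)"
    unfolding T_def by (rule separated_sequences_lepoll[OF S])
  finally show ?thesis
    by (simp add: PiE_UNIV_domain)
qed

subsection \<open>An independent family indexed by scalars\<close>

text \<open>Induction removes one base \<open>a\<close> at a time. The new coefficients are
  \<open>\<mu> l * (l - a)\<close>, and \<open>l \<noteq> a\<close> allows the factor to be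
  cancelled. Once the other coefficients vanish, only \<open>\<mu> a * a ^ n\<close> is left, and
  the decay hypothesis with \<open>r = norm a\<close> kills it.\<close>

lemma exponential_sum_superexp_small_imp_zero:
  fixes \<mu> :: "'k::real_normed_field \<Rightarrow> 'k"
  assumes "finite A" "0 \<notin> A"
    and "\<And>r. r > 0 \<Longrightarrow> (\<lambda>n. norm (\<Sum>l\<in>A. \<mu> l * l ^ n) / r ^ n) \<longlonglongrightarrow> 0"
  shows "\<forall>l\<in>A. \<mu> l = 0"
  using assms
proof (induction A arbitrary: \<mu> rule: finite_induct)
  case (insert a A)
  define \<beta> where "\<beta> n = (\<Sum>l\<in>insert a A. \<mu> l * l ^ n)" for n
  have \<beta>: "(\<lambda>n. norm (\<beta> n) / r ^ n) \<longlonglongrightarrow> 0" if "r > 0" for r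
    unfolding \<beta>_def using insert.prems(2)[OF that] .
  \<comment> \<open>Passing from \<open>\<beta> n\<close> to \<open>\<beta> (n + 1) - a * \<beta> n\<close> eliminates the exponential with base \<open>a\<close>.\<close>
  have \<gamma>: "(\<Sum>l\<in>A. \<mu> l * (l - a) * l ^ n) = \<beta> (Suc n) - a * \<beta> n" for n
  proof -
    have "\<beta> (Suc n) - a * \<beta> n = (\<Sum>l\<in>insert a A. \<mu> l * (l - a) * l ^ n)"
      by (simp add: \<beta>_def sum_distrib_left algebra_simps flip: sum_subtractf)
    then show ?thesis
      using insert.hyps by simp
  qed
  have "\<forall>l\<in>A. \<mu> l * (l - a) = 0"
  proof (rule insert.IH)
    show "0 \<notin> A"
      using insert.prems by blast
    fix r :: real assume r: "r > 0"
    have "(\<lambda>n. r * (norm (\<beta> (Suc n)) / r ^ Suc n) + norm a * (norm (\<beta> n) / r ^ n)) \<longlonglongrightarrow> r * 0 + norm a * 0"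
      using \<beta>[OF r] by (intro tendsto_intros LIMSEQ_Suc)
    then have lim: "(\<lambda>n. r * (norm (\<beta> (Suc n)) / r ^ Suc n) + norm a * (norm (\<beta> n) / r ^ n)) \<longlonglongrightarrow> 0"
      by simp
    show "(\<lambda>n. norm (\<Sum>l\<in>A. \<mu> l * (l - a) * l ^ n) / r ^ n) \<longlonglongrightarrow> 0"
    proof (rule Lim_null_comparison[OF always_eventually lim], rule allI)
      fix n
      have "norm (\<beta> (Suc n) - a * \<beta> n) \<le> norm (\<beta> (Suc n)) + norm a * norm (\<beta> n)"
        using norm_triangle_ineq4[of "\<beta> (Suc n)" "a * \<beta> n"] by (simp add: norm_mult)
      then show "norm (norm (\<Sum>l\<in>A. \<mu> l * (l - a) * l ^ n) / r ^ n) \<le>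
        r * (norm (\<beta> (Suc n)) / r ^ Suc n) + norm a * (norm (\<beta> n) / r ^ n)"
        using r by (simp add: \<gamma> divide_right_mono flip: add_divide_distrib)
    qed
  qed
  then have A0: "\<forall>l\<in>A. \<mu> l = 0"
    using insert.hyps by auto
  then have "\<beta> n = \<mu> a * a ^ n" for n
    using insert.hyps by (simp add: \<beta>_def)
  moreover have "a \<noteq> 0"
    using insert.prems by blast
  ultimately have "(\<lambda>n. norm (\<beta> n) / norm a ^ n) = (\<lambda>n. norm (\<mu> a))"
    by (simp add: norm_mult norm_power)
  with \<beta>[of "norm a"] \<open>a \<noteq> 0\<close> have "\<mu> a = 0"
    by (simp add: LIMSEQ_const_iff)
  with A0 show ?case
    by simp
qed simp

text \<open>Since (k + n + 1)^3 is at least (n + 1)^3 + k, a geometric series with ratio 1/2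
  dominates the tail; its sum is the factor 2.\<close>

lemma half_power_cube_tail:
  "(\<Sum>k. (1/2::real) ^ ((k + Suc n) ^ 3)) \<le> 2 * (1/2) ^ (Suc n ^ 3)"
  "summable (\<lambda>k. (1/2::real) ^ ((k + Suc n) ^ 3))"
proof -
  have le: "(1/2::real) ^ ((k + Suc n) ^ 3) \<le> (1/2) ^ (Suc n ^ 3) * (1/2) ^ k" for k
  proof -
    have "(k + Suc n) ^ 3 = Suc n ^ 3 + k * (k ^ 2 + 3 * k * Suc n + 3 * Suc n ^ 2)"
      by (simp add: power3_eq_cube power2_eq_square algebra_simps)
    then have "Suc n ^ 3 + k \<le> (k + Suc n) ^ 3"
      by simp
    then show ?thesis
      by (simp add: power_decreasing flip: power_add del: power_Suc)
  qed
  have geo: "summable (\<lambda>k. (1/2::real) ^ (Suc n ^ 3) * (1/2) ^ k)"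
    by (intro summable_mult summable_geometric) simp
  show summ: "summable (\<lambda>k. (1/2::real) ^ ((k + Suc n) ^ 3))"
    by (rule summable_comparison_test'[OF geo, of 0]) (use le in simp)
  have "(\<Sum>k. (1/2::real) ^ ((k + Suc n) ^ 3)) \<le> (\<Sum>k. (1/2) ^ (Suc n ^ 3) * (1/2) ^ k)"
    by (rule suminf_le[OF le summ geo])
  also have "\<dots> = 2 * (1/2) ^ (Suc n ^ 3)"
    by (subst suminf_mult) (simp_all add: summable_geometric suminf_geometric)
  finally show "(\<Sum>k. (1/2::real) ^ ((k + Suc n) ^ 3)) \<le> 2 * (1/2) ^ (Suc n ^ 3)" .
qed

text \<open>For large \<open>n\<close> the quotient (1/2)^n / r is at most 1/2, and its
  \<open>n\<close>-th power is the expression in question up to the constant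
  \<open>C\<close>.\<close>

lemma half_power_square_superexp:
  fixes r :: real
  assumes "r > 0"
  shows "(\<lambda>n. C * (1/2) ^ (n ^ 2) / r ^ n) \<longlonglongrightarrow> 0"
proof -
  obtain N where N: "1 / r < 2 ^ N"
    using real_arch_pow[of 2 "1/r"] by auto
  have geo: "(\<lambda>n. \<bar>C\<bar> * (1/2::real) ^ n) \<longlonglongrightarrow> 0"
    using tendsto_mult_right_zero[OF LIMSEQ_realpow_zero[of "1/2::real"]] by simp
  have "eventually (\<lambda>n. norm (C * (1/2) ^ (n ^ 2) / r ^ n) \<le> \<bar>C\<bar> * (1/2) ^ n) sequentially"
    using eventually_ge_at_top[of "Suc N"]
  proof eventually_elim
    case (elim n)
    have "(1/2::real) ^ n / r = (1/2) ^ n * (1 / r)"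
      by simp
    also have "\<dots> \<le> (1/2) ^ n * 2 ^ N"
      using N by (intro mult_left_mono) auto
    also have "\<dots> \<le> (1/2) ^ Suc N * 2 ^ N"
      using elim by (intro mult_right_mono power_decreasing) auto
    also have "\<dots> = 1/2"
      by (simp add: power_divide)
    finally have "((1/2) ^ n / r) ^ n \<le> (1/2) ^ n"
      using assms by (intro power_mono) auto
    then have "(1/2) ^ (n ^ 2) / r ^ n \<le> (1/2) ^ n"
      by (simp add: power_divide power_mult_distrib power2_eq_square flip: power_mult)
    then show ?case
      using assms by (simp add: abs_mult mult_left_mono flip: times_divide_eq_right)
  qed
  then show ?thesis
    by (rule Lim_null_comparison[OF _ geo])
qed

context kbanach_space
begin

text \<open>The vectors are chosen recursively by Riesz's lemma: the span of finitely many
  predecessors is closed, and proper by infinite dimension.\<close>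

lemma almost_orthogonal_sequence:
  assumes "infinite_dim sc"
  obtains x :: "nat \<Rightarrow> 'x" where "\<And>n. norm (x n) \<le> 1"
    "\<And>n m. m \<in> span (x ` {..<n}) \<Longrightarrow> 1/2 \<le> norm (x n - m)"
proof -
  have "\<exists>x :: nat \<Rightarrow> 'x. \<forall>n. norm (x n) \<le> 1 \<and> (\<forall>m\<in>span (x ` {..<n}). 1/2 \<le> norm (x n - m))"
  \<comment> \<open>This choice principle asks that the condition on the \<open>n\<close>-th vector
    depend only on the earlier vectors, and that it can always be met.\<close>
  proof (rule dependent_wellorder_choice)
    fix r :: 'x and f g :: "nat \<Rightarrow> 'x" and n
    assume "\<And>k. k < n \<Longrightarrow> f k = g k"
    then have "f ` {..<n} = g ` {..<n}"
      by (intro image_cong) auto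
    then show "(norm r \<le> 1 \<and> (\<forall>m\<in>span (f ` {..<n}). 1/2 \<le> norm (r - m))) =
      (norm r \<le> 1 \<and> (\<forall>m\<in>span (g ` {..<n}). 1/2 \<le> norm (r - m)))"
      by simp
  next
    fix n and f :: "nat \<Rightarrow> 'x"
    have "finite (f ` {..<n})"
      by simp
    then have "span (f ` {..<n}) \<noteq> UNIV" "closed (span (f ` {..<n}))"
      using assms closed_span_finite unfolding infinite_dim_def by blast+
    then show "\<exists>r. norm r \<le> 1 \<and> (\<forall>m\<in>span (f ` {..<n}). 1/2 \<le> norm (r - m))"
      using riesz_lemma_half[OF real_subspace_if_subspace[OF subspace_span]] by metis
  qed
  with that show ?thesis
    by blast
qed

text \<open>Since the series vanishes, the partial sum through index \<open>n\<close> is minus the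
  tail. Its norm is at least \<open>norm (\<beta> n) * c n / 2\<close> by almost orthogonality and
  at most \<open>2 * C * c (Suc n)\<close>. The cubic exponent makes the ratio of consecutive
  weights at most (1/2)^(n^2).\<close>

lemma almost_orthogonal_series_zero:
  fixes x :: "nat \<Rightarrow> 'x"
  assumes x: "\<And>n. norm (x n) \<le> 1" "\<And>n m. m \<in> span (x ` {..<n}) \<Longrightarrow> 1/2 \<le> norm (x n - m)"
    and bound: "\<And>n. norm (\<beta> n) \<le> C"
    and zero: "(\<Sum>n. sc (\<beta> n * of_real ((1/2) ^ (n ^ 3))) (x n)) = 0"
  shows "norm (\<beta> n) \<le> 4 * C * (1/2) ^ (n ^ 2)"
proof -
  define c :: "nat \<Rightarrow> real" where "c = (\<lambda>n. (1/2) ^ (n ^ 3))"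
  have c: "c n > 0" for n
    by (simp add: c_def)
  define f where "f = (\<lambda>n. sc (\<beta> n * of_real (c n)) (x n))"
  have C: "C \<ge> 0"
    using order_trans[OF norm_ge_zero bound] .
  have f_le: "norm (f n) \<le> C * c n" for n
  proof -
    have "norm (f n) = norm (\<beta> n) * (c n * norm (x n))"
      using c[of n] by (simp add: f_def norm_scale norm_mult)
    also have "\<dots> \<le> C * (c n * 1)"
      using x(1)[of n] bound[of n] c[of n] C by (intro mult_mono mult_left_mono) auto
    finally show ?thesis
      by simp
  qed
  have "summable (\<lambda>k. C * c (k + Suc n))" for n
    unfolding c_def by (intro summable_mult half_power_cube_tail)
  note csumm = this
  have "summable (\<lambda>k. f (k + Suc 0))"
    by (rule summable_comparison_test'[OF csumm[of 0], of 0]) (use f_le in simp)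
  then have "summable f"
    by (simp add: summable_Suc_iff)
  then have "suminf f = (\<Sum>k. f (k + Suc n)) + (\<Sum>k<Suc n. f k)"
    by (rule suminf_split_initial_segment)
  moreover have "suminf f = 0"
    unfolding f_def c_def by (rule zero)
  ultimately have "f n + (\<Sum>k<n. f k) = - (\<Sum>k. f (k + Suc n))"
    by (simp add: eq_neg_iff_add_eq_0 add_ac)
  then have "norm (f n + (\<Sum>k<n. f k)) = norm (\<Sum>k. f (k + Suc n))"
    by (metis norm_minus_cancel)
  also have "\<dots> \<le> (\<Sum>k. C * c (k + Suc n))"
    by (rule norm_suminf_le[OF f_le csumm])
  also have "\<dots> = C * (\<Sum>k. c (k + Suc n))"
    unfolding c_def by (rule suminf_mult[OF half_power_cube_tail(2)])
  also have "\<dots> \<le> C * (2 * c (Suc n))"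
    using half_power_cube_tail(1)[of n] C unfolding c_def by (rule mult_left_mono)
  also have "c (Suc n) \<le> (1/2) ^ (n ^ 2) * c n"
  proof -
    have "n ^ 2 + n ^ 3 \<le> Suc n ^ 3"
      by (simp add: power3_eq_cube power2_eq_square algebra_simps)
    then show ?thesis
      unfolding c_def by (simp add: power_decreasing flip: power_add del: power_Suc)
  qed
  finally have upper: "norm (f n + (\<Sum>k<n. f k)) \<le> C * (2 * ((1/2) ^ (n ^ 2) * c n))"
    using C by (simp add: mult_left_mono)
  \<comment> \<open>After division by the coefficient \<open>b\<close> of \<open>x n\<close>, the
    earlier terms become an element of the span of the predecessors, to which the distance bound
    applies.\<close>
  have lower: "norm (\<beta> n) * c n * (1/2) \<le> norm (f n + (\<Sum>k<n. f k))"
  proof (cases "\<beta> n = 0")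
    case False
    define b where "b = \<beta> n * of_real (c n)"
    have b: "b \<noteq> 0" "norm b = norm (\<beta> n) * c n"
      using False c[of n] by (auto simp: b_def norm_mult)
    have fn: "f n = sc b (x n)"
      by (simp add: f_def b_def)
    have "(\<Sum>k<n. f k) \<in> span (x ` {..<n})"
      unfolding f_def by (intro span_sum span_scale span_base) auto
    then have "1/2 \<le> norm (x n - sc (- inverse b) (\<Sum>k<n. f k))"
      by (intro x(2) span_scale)
    then have "norm b * (1/2) \<le> norm b * norm (x n - sc (- inverse b) (\<Sum>k<n. f k))"
      by (intro mult_left_mono) auto
    also have "\<dots> = norm (sc b (x n - sc (- inverse b) (\<Sum>k<n. f k)))"
      by (simp add: norm_scale)
    also have "sc b (x n - sc (- inverse b) (\<Sum>k<n. f k)) = f n + (\<Sum>k<n. f k)"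
      using b(1) fn by (simp add: scale_right_distrib)
    finally show ?thesis
      using b(2) by simp
  qed simp
  have "norm (\<beta> n) * c n * (1/2) \<le> C * (2 * ((1/2) ^ (n ^ 2) * c n))"
    using lower upper by (rule order_trans)
  also have "\<dots> = (4 * C * (1/2) ^ (n ^ 2)) * c n * (1/2)"
    by simp
  finally show ?thesis
    using c[of n] by simp
qed

text \<open>The vectors \<open>v l\<close>, with \<open>l\<close> in the punctured unit ball
  \<open>L\<close> of the field, are independent and extend to a Hamel basis. The ball is as large
  as the field because every scalar is coded by a pair from \<open>L\<close>.\<close>

lemma scalars_lepoll_basis:
  assumes "infinite_dim sc"
  obtains B where "independent B" "span B = UNIV" "infinite B" "(UNIV :: 'k set) \<lesssim> B"
proof -
  obtain x :: "nat \<Rightarrow> 'x" where x: "\<And>n. norm (x n) \<le> 1"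
    "\<And>n m. m \<in> span (x ` {..<n}) \<Longrightarrow> 1/2 \<le> norm (x n - m)"
    using almost_orthogonal_sequence[OF assms] by blast
  define L where "L = {l :: 'k. l \<noteq> 0 \<and> norm l \<le> 1}"
  define c :: "nat \<Rightarrow> real" where "c = (\<lambda>n. (1/2) ^ (n ^ 3))"
  have c: "c n > 0" for n
    by (simp add: c_def)
  define f where "f = (\<lambda>l n. sc (l ^ n * of_real (c n)) (x n))"
  define v where "v = (\<lambda>l. suminf (f l))"
  have "summable (\<lambda>k. c (k + Suc 0))"
    unfolding c_def by (rule half_power_cube_tail)
  then have csumm: "summable c"
    by (simp add: summable_Suc_iff)
  have fsumm: "summable (f l)" if "l \<in> L" for l
  proof (rule summable_comparison_test'[OF csumm])
    fix n
    have "norm (f l n) = norm l ^ n * c n * norm (x n)"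
      using c[of n] by (simp add: f_def norm_scale norm_mult norm_power)
    also have "\<dots> \<le> 1 * c n * 1"
      using that x(1)[of n] c[of n] by (intro mult_mono power_le_one) (auto simp: L_def)
    finally show "norm (f l n) \<le> c n"
      by simp
  qed
  \<comment> \<open>A relation among the \<open>v l\<close> is a vanishing series in the
    \<open>x n\<close> with the exponential sums \<open>\<beta> n\<close> as coefficients. Almost
    orthogonality forces superexponential decay of \<open>\<beta>\<close>, so every
    \<open>\<mu> l\<close> is zero.\<close>
  have indep: "\<mu> l = 0" if A: "finite A" "A \<subseteq> L" and sum0: "(\<Sum>l\<in>A. sc (\<mu> l) (v l)) = 0" and l: "l \<in> A"
    for A \<mu> l
  proof -
    define \<beta> where "\<beta> = (\<lambda>n. \<Sum>l\<in>A. \<mu> l * l ^ n)"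
    have "(\<lambda>n. \<Sum>l\<in>A. sc (\<mu> l) (f l n)) sums (\<Sum>l\<in>A. sc (\<mu> l) (v l))"
      unfolding v_def using A fsumm
      by (intro sums_sum bounded_linear.sums[OF scale.bounded_linear_right] summable_sums) auto
    moreover have "(\<Sum>l\<in>A. sc (\<mu> l) (f l n)) = sc (\<beta> n * of_real (c n)) (x n)" for n
      by (simp add: f_def \<beta>_def sum_distrib_right mult.assoc flip: scale_sum_left)
    ultimately have zero: "(\<Sum>n. sc (\<beta> n * of_real (c n)) (x n)) = 0"
      using sum0 by (simp add: sums_iff)
    have bound: "norm (\<beta> n) \<le> (\<Sum>l\<in>A. norm (\<mu> l))" for n
      unfolding \<beta>_def
    proof (rule sum_norm_le)
      fix l assume "l \<in> A"
      then have "norm l ^ n \<le> 1"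
        using A by (intro power_le_one) (auto simp: L_def)
      then show "norm (\<mu> l * l ^ n) \<le> norm (\<mu> l)"
        by (simp add: norm_mult norm_power mult_left_le)
    qed
    define D where "D = 4 * (\<Sum>l\<in>A. norm (\<mu> l))"
    have small: "norm (\<beta> n) \<le> D * (1/2) ^ (n ^ 2)" for n
      unfolding D_def by (rule almost_orthogonal_series_zero[OF x bound zero[unfolded c_def]])
    have "\<forall>l\<in>A. \<mu> l = 0"
    proof (rule exponential_sum_superexp_small_imp_zero[OF A(1)])
      show "0 \<notin> A"
        using A by (auto simp: L_def)
      fix r :: real assume r: "r > 0"
      show "(\<lambda>n. norm (\<Sum>l\<in>A. \<mu> l * l ^ n) / r ^ n) \<longlonglongrightarrow> 0"
      proof (rule Lim_null_comparison[OF always_eventually half_power_square_superexp[OF r, of D]], rule allI)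
        fix n
        show "norm (norm (\<Sum>l\<in>A. \<mu> l * l ^ n) / r ^ n) \<le> D * (1/2) ^ (n ^ 2) / r ^ n"
          using small[of n] r by (simp add: \<beta>_def divide_right_mono)
      qed
    qed
    then show ?thesis
      using l by blast
  qed
  have inj: "inj_on v L"
  proof (rule inj_onI, rule ccontr)
    fix l m assume lm: "l \<in> L" "m \<in> L" "v l = v m" "l \<noteq> m"
    \<comment> \<open>A coincidence \<open>v l = v m\<close> is the linear relation with
      coefficients 1 and -1.\<close>
    have "(\<lambda>k. if k = l then 1 else - 1) l = (0 :: 'k)"
      using lm by (intro indep[of "{l, m}"]) auto
    then show False
      by simp
  qed
  have "independent (v ` L)"
    unfolding independent_explicit_finite_subsets
  proof (intro allI impI ballI)
    fix S u w assume S: "S \<subseteq> v ` L" "finite S" "(\<Sum>y\<in>S. sc (u y) y) = 0" "w \<in> S"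
    obtain A where A: "A \<subseteq> L" "finite A" "S = v ` A"
      using finite_subset_image[OF S(2,1)] by blast
    have "(\<Sum>l\<in>A. sc (u (v l)) (v l)) = 0"
      using S(3) A inj by (simp add: sum.reindex inj_on_subset)
    then show "u w = 0"
      using indep[OF A(2,1), of "\<lambda>l. u (v l)"] S(4) A(3) by auto
  qed
  then obtain B where B: "v ` L \<subseteq> B" "independent B" "UNIV \<subseteq> span B"
    by (rule maximal_independent_subset_extend[OF subset_UNIV])
  have "L \<lesssim> B"
    unfolding lepoll_def using inj B(1) by blast
  have "inj (\<lambda>n. inverse (of_nat (Suc n)) :: 'k)"
    by (simp add: inj_def del: of_nat_Suc)
  moreover have "range (\<lambda>n. inverse (of_nat (Suc n)) :: 'k) \<subseteq> L"
    by (auto simp: L_def norm_inverse inverse_le_1_iff simp del: of_nat_Suc)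
  ultimately have "(UNIV :: nat set) \<lesssim> L"
    unfolding lepoll_def by blast
  then have "infinite L"
    by (simp add: infinite_le_lepoll)
  have "infinite B"
    using lepoll_trans[OF \<open>UNIV \<lesssim> L\<close> \<open>L \<lesssim> B\<close>] by (simp add: infinite_le_lepoll)
  \<comment> \<open>A nonzero \<open>l\<close> is the quotient of \<open>l * r\<close> by
    \<open>r\<close>, where \<open>r = 1 / (2 + norm l)\<close> puts both into \<open>L\<close>. As
    \<open>r < 1\<close>, the denominator 1 stays free to code the scalar 0, which is no quotient of
    elements of \<open>L\<close>.\<close>
  have "(UNIV :: 'k set) \<lesssim> L \<times> L"
  proof (rule subset_image_lepoll, rule subsetI)
    fix l :: 'k
    define r where "r = 1 / (2 + norm l)"
    have pos: "0 < 2 + norm l" "1 < 2 + norm l"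
      using norm_ge_zero[of l] by linarith+
    have r: "0 < r" "r < 1" "norm l * r \<le> 1"
      using pos by (simp_all add: r_def field_simps)
    show "l \<in> (\<lambda>(a, b). if b = 1 then 0 else a / b) ` (L \<times> L)"
    proof (cases "l = 0")
      case True
      then show ?thesis
        by (intro image_eqI[of _ _ "(1, 1)"]) (auto simp: L_def)
    next
      case False
      then show ?thesis
        using r by (intro image_eqI[of _ _ "(l * of_real r, of_real r)"]) (auto simp: L_def norm_mult)
    qed
  qed
  also have "\<dots> \<lesssim> L"
    by (rule infinite_times_self_lepoll[OF \<open>infinite L\<close>])
  also note \<open>L \<lesssim> B\<close>
  finally show ?thesis
    using that B \<open>infinite B\<close> by blast
qed

end

subsection \<open>The subspace of elementary tensors\<close>

lemma openin_metric_top: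
  "openin (metric_top S d) U \<longleftrightarrow> U \<subseteq> S \<and> (\<forall>x\<in>U. \<exists>e>0. \<forall>y\<in>S. d x y < e \<longrightarrow> y \<in> U)"
proof -
  \<comment> \<open>\<open>topology\<close> is an abstraction function: \<open>openin\<close>
    returns the given predicate once that predicate is known to satisfy
    \<open>istopology\<close>.\<close>
  have "istopology (\<lambda>U. U \<subseteq> S \<and> (\<forall>x\<in>U. \<exists>e>0. \<forall>y\<in>S. d x y < e \<longrightarrow> y \<in> U))"
    unfolding istopology_def
  proof (intro conjI allI impI)
    fix U V
    assume U: "U \<subseteq> S \<and> (\<forall>x\<in>U. \<exists>e>0. \<forall>y\<in>S. d x y < e \<longrightarrow> y \<in> U)"
      and V: "V \<subseteq> S \<and> (\<forall>x\<in>V. \<exists>e>0. \<forall>y\<in>S. d x y < e \<longrightarrow> y \<in> V)"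
    show "U \<inter> V \<subseteq> S"
      using U by blast
    show "\<forall>x\<in>U \<inter> V. \<exists>e>0. \<forall>y\<in>S. d x y < e \<longrightarrow> y \<in> U \<inter> V"
    proof
      fix x assume x: "x \<in> U \<inter> V"
      obtain e where e: "e > 0" "\<forall>y\<in>S. d x y < e \<longrightarrow> y \<in> U"
        using U x by blast
      obtain e' where e': "e' > 0" "\<forall>y\<in>S. d x y < e' \<longrightarrow> y \<in> V"
        using V x by blast
      show "\<exists>e>0. \<forall>y\<in>S. d x y < e \<longrightarrow> y \<in> U \<inter> V"
        using e e' by (intro exI[of _ "min e e'"]) auto
    qed
  next
    fix \<K> assume \<K>: "\<forall>K\<in>\<K>. K \<subseteq> S \<and> (\<forall>x\<in>K. \<exists>e>0. \<forall>y\<in>S. d x y < e \<longrightarrow> y \<in> K)"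
    show "\<Union>\<K> \<subseteq> S"
      using \<K> by blast
    show "\<forall>x\<in>\<Union>\<K>. \<exists>e>0. \<forall>y\<in>S. d x y < e \<longrightarrow> y \<in> \<Union>\<K>"
      using \<K> by (meson UnionE UnionI)
  qed
  then show ?thesis
    by (simp add: metric_top_def)
qed

lemma openin_seminorm_top:
  "openin (seminorm_top S \<sigma>) U \<longleftrightarrow>
    U \<subseteq> S \<and> (\<forall>x\<in>U. \<exists>I e. finite I \<and> e > 0 \<and> {y\<in>S. \<forall>i\<in>I. \<sigma> i (y - x) < e} \<subseteq> U)"
proof -
  have "istopology (\<lambda>U. U \<subseteq> S \<and>
    (\<forall>x\<in>U. \<exists>I e. finite I \<and> e > 0 \<and> {y\<in>S. \<forall>i\<in>I. \<sigma> i (y - x) < e} \<subseteq> U))"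
    unfolding istopology_def
  proof (intro conjI allI impI)
    fix U V
    assume U: "U \<subseteq> S \<and> (\<forall>x\<in>U. \<exists>I e. finite I \<and> e > 0 \<and> {y\<in>S. \<forall>i\<in>I. \<sigma> i (y - x) < e} \<subseteq> U)"
      and V: "V \<subseteq> S \<and> (\<forall>x\<in>V. \<exists>I e. finite I \<and> e > 0 \<and> {y\<in>S. \<forall>i\<in>I. \<sigma> i (y - x) < e} \<subseteq> V)"
    show "U \<inter> V \<subseteq> S"
      using U by blast
    show "\<forall>x\<in>U \<inter> V. \<exists>I e. finite I \<and> e > 0 \<and> {y\<in>S. \<forall>i\<in>I. \<sigma> i (y - x) < e} \<subseteq> U \<inter> V"
    proof
      fix x assume x: "x \<in> U \<inter> V"
      obtain I e where e: "finite I" "e > 0" "{y\<in>S. \<forall>i\<in>I. \<sigma> i (y - x) < e} \<subseteq> U"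
        using U x by blast
      obtain I' e' where e': "finite I'" "e' > 0" "{y\<in>S. \<forall>i\<in>I'. \<sigma> i (y - x) < e'} \<subseteq> V"
        using V x by blast
      show "\<exists>I e. finite I \<and> e > 0 \<and> {y\<in>S. \<forall>i\<in>I. \<sigma> i (y - x) < e} \<subseteq> U \<inter> V"
        using e e' by (intro exI[of _ "I \<union> I'"] exI[of _ "min e e'"]) auto
    qed
  next
    fix \<K> assume \<K>: "\<forall>K\<in>\<K>. K \<subseteq> S \<and>
      (\<forall>x\<in>K. \<exists>I e. finite I \<and> e > 0 \<and> {y\<in>S. \<forall>i\<in>I. \<sigma> i (y - x) < e} \<subseteq> K)"
    show "\<Union>\<K> \<subseteq> S"
      using \<K> by blast
    show "\<forall>x\<in>\<Union>\<K>. \<exists>I e. finite I \<and> e > 0 \<and> {y\<in>S. \<forall>i\<in>I. \<sigma> i (y - x) < e} \<subseteq> \<Union>\<K>"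
    proof
      fix x assume "x \<in> \<Union>\<K>"
      then obtain K where K: "K \<in> \<K>" "x \<in> K"
        by blast
      obtain I e where "finite I" "e > 0" "{y\<in>S. \<forall>i\<in>I. \<sigma> i (y - x) < e} \<subseteq> K"
        using bspec[OF conjunct2[OF bspec[OF \<K> K(1)]] K(2)] by blast
      with K show "\<exists>I e. finite I \<and> e > 0 \<and> {y\<in>S. \<forall>i\<in>I. \<sigma> i (y - x) < e} \<subseteq> \<Union>\<K>"
        by (intro exI[of _ I] exI[of _ e]) auto
    qed
  qed
  then show ?thesis
    by (simp add: seminorm_top_def)
qed

lemma topspace_metric_top: "topspace (metric_top S d) = S"
proof (rule antisym)
  show "topspace (metric_top S d) \<subseteq> S"
    using openin_topspace[of "metric_top S d"] unfolding openin_metric_top by blast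
  show "S \<subseteq> topspace (metric_top S d)"
    by (rule openin_subset) (auto simp: openin_metric_top intro: exI[of _ 1])
qed

lemma topspace_seminorm_top: "topspace (seminorm_top S \<sigma>) = S"
proof (rule antisym)
  show "topspace (seminorm_top S \<sigma>) \<subseteq> S"
    using openin_topspace[of "seminorm_top S \<sigma>"] unfolding openin_seminorm_top by blast
  show "S \<subseteq> topspace (seminorm_top S \<sigma>)"
    by (rule openin_subset) (auto simp: openin_seminorm_top intro: exI[of _ "{}"] exI[of _ 1])
qed

section \<open>Closedness of the space of elementary tensors\<close>

context kbanach_space
begin

lemma vector_space_seq_scale: "vector_space (seq_scale sc)"
  by unfold_locales (auto simp: seq_scale_def fun_eq_iff scale_right_distrib scale_left_distrib)

lemma linear_tensor: "Vector_Spaces.linear sc (seq_scale sc) (tensor sc a)"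
proof -
  interpret s: vector_space "seq_scale sc"
    by (rule vector_space_seq_scale)
  show ?thesis
    by unfold_locales (auto simp: tensor_def seq_scale_def fun_eq_iff scale_right_distrib mult.commute)
qed

lemma inj_tensor:
  assumes "a \<noteq> 0"
  shows "inj (tensor sc a)"
proof (rule injI)
  fix x y assume eq: "tensor sc a x = tensor sc a y"
  obtain j where "a j \<noteq> 0"
    using assms by (auto simp: fun_eq_iff)
  with fun_cong[OF eq, of j] show "x = y"
    by (simp add: tensor_def)
qed

text \<open>By translation invariance the bounds compare distances between tensors with
  \<open>norm (x - y)\<close>, the number \<open>D\<close> standing for the distance of
  \<open>a\<close> from 0. Tensors approaching \<open>w\<close> thus come from a Cauchy sequence in
  the Banach space, and the tensor of its limit equals \<open>w\<close>.\<close>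

lemma closedin_range_tensor_metric:
  assumes d: "metric_on E d" "translation_invariant E d"
    and E: "range (tensor sc a) \<subseteq> E"
    and "0 < L" "0 < D"
    and bounds: "\<And>x. L * norm x * D \<le> d (tensor sc a x) 0" "\<And>x. d (tensor sc a x) 0 \<le> M * norm x * D"
  shows "closedin (metric_top E d) (range (tensor sc a))"
proof -
  interpret t: Vector_Spaces.linear sc "seq_scale sc" "tensor sc a"
    by (rule linear_tensor)
  have mem: "tensor sc a x \<in> E" for x
    using E by blast
  have dist_eq: "d (tensor sc a x) (tensor sc a y) = d (tensor sc a (x - y)) 0" for x y
  proof -
    have "0 \<in> E"
      using mem[of 0] by (simp add: t.zero)
    then have "d (tensor sc a (x - y) + tensor sc a y) (0 + tensor sc a y) = d (tensor sc a (x - y)) 0"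
      using d(2) mem unfolding translation_invariant_def by blast
    then show ?thesis
      by (simp flip: t.add)
  qed
  have tri: "d u w \<le> d u v + d v w" if "u \<in> E" "v \<in> E" "w \<in> E" for u v w
    using d(1) that unfolding metric_on_def by blast
  have sym: "d u v = d v u" if "u \<in> E" "v \<in> E" for u v
    using d(1) that unfolding metric_on_def by blast
  have "\<exists>e>0. \<forall>v\<in>E. d w v < e \<longrightarrow> v \<notin> range (tensor sc a)"
    if w: "w \<in> E" "w \<notin> range (tensor sc a)" for w
  proof (rule ccontr)
    assume "\<not> ?thesis"
    then have "\<forall>n. \<exists>x. d w (tensor sc a x) < inverse (real (Suc n))"
      by (metis inverse_positive_iff_positive of_nat_0_less_iff rangeE zero_less_Suc)
    then obtain x where x: "\<And>n. d w (tensor sc a (x n)) < inverse (real (Suc n))"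
      by metis
    have "L * D > 0"
      using assms by simp
    have "Cauchy x"
    proof (rule CauchyI)
      fix e :: real assume "e > 0"
      then have "e * (L * D) / 2 > 0"
        using \<open>L * D > 0\<close> by simp
      then obtain N where N: "inverse (real (Suc N)) < e * (L * D) / 2"
        using reals_Archimedean by blast
      have near: "d w (tensor sc a (x n)) < e * (L * D) / 2" if "n \<ge> N" for n
      proof -
        have "inverse (real (Suc n)) \<le> inverse (real (Suc N))"
          using that by (simp add: le_imp_inverse_le)
        with x[of n] N show ?thesis
          by linarith
      qed
      have "norm (x m - x n) < e" if "m \<ge> N" "n \<ge> N" for m n
      proof -
        have "norm (x m - x n) * (L * D) \<le> d (tensor sc a (x m)) (tensor sc a (x n))"
          using bounds(1)[of "x m - x n"] by (simp add: dist_eq mult_ac)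
        also have "\<dots> \<le> d (tensor sc a (x m)) w + d w (tensor sc a (x n))"
          using mem w by (intro tri) auto
        also have "\<dots> < e * (L * D)"
          using near[OF that(1)] near[OF that(2)] sym[OF mem w(1), of "x m"] by simp
        finally show ?thesis
          using \<open>L * D > 0\<close> by (simp add: mult_less_cancel_right)
      qed
      then show "\<exists>N. \<forall>m\<ge>N. \<forall>n\<ge>N. norm (x m - x n) < e"
        by blast
    qed
    then obtain y where y: "x \<longlonglongrightarrow> y"
      using Cauchy_convergent_iff convergent_def by blast
    have le: "d w (tensor sc a y) \<le> inverse (real (Suc n)) + M * norm (x n - y) * D" for n
      using tri[OF w(1) mem[of "x n"] mem[of y]] x[of n] bounds(2)[of "x n - y"] dist_eq[of "x n" y]
      by linarith
    have "(\<lambda>n. inverse (real (Suc n)) + M * norm (x n - y) * D) \<longlonglongrightarrow> 0 + M * norm (y - y) * D"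
      by (intro tendsto_intros y LIMSEQ_inverse_real_of_nat)
    then have "d w (tensor sc a y) \<le> 0"
      using le LIMSEQ_le_const by (metis (no_types, lifting) add_0 cancel_comm_monoid_add_class.diff_cancel mult_zero_left mult_zero_right norm_zero)
    then have "w = tensor sc a y"
      using d(1) w(1) mem[of y] unfolding metric_on_def by (meson order_antisym)
    with w(2) show False
      by blast
  qed
  then show ?thesis
    using E by (auto simp: closedin_def topspace_metric_top openin_metric_top)
qed

text \<open>One seminorm controls all coordinates, so failure to be a multiple of \<open>a\<close>
  is visible in two coordinates and persists on a small seminorm ball.\<close>

lemma closedin_range_tensor_seminorm:
  fixes \<sigma> :: "'i \<Rightarrow> (nat \<Rightarrow> 'x) \<Rightarrow> real"
  assumes E: "range (tensor sc a) \<subseteq> E" "lin_subspace sc E"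
    and "a \<noteq> 0" "0 < K"
    and bound: "\<And>w j. w \<in> E \<Longrightarrow> norm (w j) \<le> K * \<sigma> i w"
  shows "closedin (seminorm_top E \<sigma>) (range (tensor sc a))"
proof -
  obtain j0 where j0: "a j0 \<noteq> 0"
    using \<open>a \<noteq> 0\<close> by (auto simp: fun_eq_iff)
  have "\<exists>I e. finite I \<and> e > 0 \<and> {v\<in>E. \<forall>i\<in>I. \<sigma> i (v - w) < e} \<subseteq> E - range (tensor sc a)"
    if w: "w \<in> E" "w \<notin> range (tensor sc a)" for w
  proof -
    \<comment> \<open>The only candidate for \<open>w = a \<otimes> x\<close> is \<open>x = w j0 / a j0\<close>; it fails at some coordinate \<open>j\<close>.\<close>
    define x where "x = sc (inverse (a j0)) (w j0)"
    have wx: "w j0 = sc (a j0) x"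
      using j0 by (simp add: x_def)
    obtain j where j: "w j \<noteq> sc (a j) x"
      using w(2) by (auto simp: tensor_def fun_eq_iff)
    \<comment> \<open>If \<open>a \<otimes> y\<close> has seminorm distance \<open>s\<close> from
      \<open>w\<close>, coordinate \<open>j0\<close> bounds \<open>norm (y - x)\<close> by
      \<open>K * s / norm (a j0)\<close>, and coordinate \<open>j\<close> then gives
      \<open>\<delta> \<le> R * s\<close>. Radius \<open>\<delta> / R\<close> therefore excludes all
      tensors.\<close>
    define \<delta> where "\<delta> = norm (w j - sc (a j) x)"
    define R where "R = K * (1 + norm (a j) / norm (a j0))"
    have "R > 0" "\<delta> > 0"
      using j \<open>0 < K\<close> by (auto simp: R_def \<delta>_def intro!: mult_pos_pos add_pos_nonneg)
    have "v \<notin> range (tensor sc a)" if v: "v \<in> E" "\<sigma> i (v - w) < \<delta> / R" for v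
    proof
      assume "v \<in> range (tensor sc a)"
      then obtain y where y: "v = tensor sc a y"
        by blast
      \<comment> \<open>The coordinate bound holds only on \<open>E\<close>, so \<open>v - w\<close>
        is first placed there.\<close>
      have "seq_scale sc (- 1) w \<in> E"
        using E(2) w(1) by (simp add: lin_subspace_def)
      then have "v + seq_scale sc (- 1) w \<in> E"
        using E(2) v(1) by (simp add: lin_subspace_def)
      moreover have "v + seq_scale sc (- 1) w = v - w"
        by (simp add: fun_eq_iff seq_scale_def)
      ultimately have "v - w \<in> E"
        by simp
      define s where "s = \<sigma> i (v - w)"
      have vw: "norm (sc (a k) y - w k) \<le> K * s" for k
        using bound[OF \<open>v - w \<in> E\<close>, of k] by (simp add: y tensor_def s_def)
      have "norm (a j0) * norm (y - x) \<le> K * s"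
        using vw[of j0] by (simp add: wx norm_scale flip: scale_right_diff_distrib)
      then have "norm (y - x) \<le> K * s / norm (a j0)"
        using j0 by (simp add: field_simps)
      then have yx: "norm (a j) * norm (y - x) \<le> norm (a j) * (K * s / norm (a j0))"
        by (intro mult_left_mono) auto
      have "w j - sc (a j) x = sc (a j) (y - x) - (sc (a j) y - w j)"
        by (simp add: scale_right_diff_distrib)
      then have "\<delta> \<le> norm (a j) * norm (y - x) + norm (sc (a j) y - w j)"
        unfolding \<delta>_def by (metis norm_triangle_ineq4 norm_scale)
      also have "\<dots> \<le> norm (a j) * (K * s / norm (a j0)) + K * s"
        by (rule add_mono[OF yx vw])
      also have "\<dots> = R * s"
        by (simp add: R_def algebra_simps)
      also have "\<dots> < R * (\<delta> / R)"
        using v(2) \<open>R > 0\<close> by (simp add: s_def mult_strict_left_mono del: times_divide_eq_right)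
      also have "\<dots> = \<delta>"
        using \<open>R > 0\<close> by simp
      finally show False
        by simp
    qed
    then show ?thesis
      using \<open>R > 0\<close> \<open>\<delta> > 0\<close> by (intro exI[of _ "{i}"] exI[of _ "\<delta> / R"]) auto
  qed
  then show ?thesis
    using E(1) by (auto simp: closedin_def topspace_seminorm_top openin_seminorm_top)
qed

section \<open>Dimension of the space of elementary tensors\<close>

text \<open>A real span lies inside the span over the field, so infinite dimension passes to the
  real scalars used in the cardinality count.\<close>

lemma not_finite_real_span:
  assumes "infinite_dim sc"
  shows "\<not> (\<exists>B :: 'x set. finite B \<and> Real_Vector_Spaces.span B = UNIV)"
proof
  assume "\<exists>B :: 'x set. finite B \<and> Real_Vector_Spaces.span B = UNIV"
  then obtain B :: "'x set" where B: "finite B" "Real_Vector_Spaces.span B = UNIV"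
    by blast
  have "Real_Vector_Spaces.span B \<subseteq> span B"
    by (rule Real_Vector_Spaces.span_minimal[OF _ real_subspace_if_subspace[OF subspace_span]])
      (auto intro: span_base)
  with B assms show False
    by (auto simp: infinite_dim_def)
qed

text \<open>The image \<open>B\<close> of a basis \<open>B0\<close> of \<open>X\<close> extends to a
  basis \<open>C\<close> of \<open>E\<close>. Then \<open>C\<close> injects successively into the
  sequences in \<open>X\<close>, into \<open>X\<close>, into \<open>B0\<close> (which is at least as
  large as the field), and into \<open>B\<close>.\<close>

lemma hamel_basis_range_tensor_eqpoll:
  assumes inf: "infinite_dim sc" and "a \<noteq> 0"
    and E: "lin_subspace sc E" "range (tensor sc a) \<subseteq> E"
  obtains B C where "hamel_basis (seq_scale sc) B (range (tensor sc a))" "hamel_basis (seq_scale sc) C E" "B \<approx> C"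
proof -
  interpret t: Vector_Spaces.linear sc "seq_scale sc" "tensor sc a"
    by (rule linear_tensor)
  obtain B0 where B0: "independent B0" "span B0 = UNIV" "infinite B0" "(UNIV :: 'k set) \<lesssim> B0"
    by (rule scalars_lepoll_basis[OF inf])
  define B where "B = tensor sc a ` B0"
  have inj: "inj_on (tensor sc a) S" for S
    by (rule inj_on_subset[OF inj_tensor[OF \<open>a \<noteq> 0\<close>] subset_UNIV])
  have B: "B \<subseteq> range (tensor sc a)" "t.vs2.independent B" "t.vs2.span B = range (tensor sc a)"
    using t.span_image[of B0] B0(2) t.independent_injective_image[OF B0(1) inj]
    unfolding B_def by auto
  have sub: "t.vs2.subspace E"
    using E(1) by (auto simp: t.vs2.subspace_def lin_subspace_def)
  obtain C where C: "B \<subseteq> C" "C \<subseteq> E" "t.vs2.independent C" "E \<subseteq> t.vs2.span C"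
    using t.vs2.maximal_independent_subset_extend[OF subset_trans[OF B(1) E(2)] B(2)] by blast
  have "t.vs2.span C = E"
    using C t.vs2.span_minimal[OF C(2) sub] by blast
  have "C \<lesssim> (UNIV :: (nat \<Rightarrow> 'x) set)"
    by (rule subset_imp_lepoll) simp
  also have "\<dots> \<lesssim> (UNIV :: 'x set)"
    by (rule sequences_lepoll_banach[OF not_finite_real_span[OF inf]])
  also have "\<dots> \<lesssim> B0"
    using span_lepoll[OF B0(3,4)] B0(2) by simp
  also have "B0 \<lesssim> B"
    unfolding lepoll_def B_def using inj by blast
  finally have "B \<approx> C"
    using subset_imp_lepoll[OF C(1)] by (intro lepoll_antisym)
  with B C \<open>t.vs2.span C = E\<close> show ?thesis
    by (intro that[of B C]) (auto simp: hamel_basis_def)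
qed

end

theorem theorem1:
  fixes sc :: "'k::{real_normed_field,banach} \<Rightarrow> 'x::banach \<Rightarrow> 'x"
    and GE :: "'p set" and EK :: "'p \<Rightarrow> (nat \<Rightarrow> 'k) set" and EXs :: "'p \<Rightarrow> (nat \<Rightarrow> 'x) set"
    and dEK :: "'p \<Rightarrow> (nat \<Rightarrow> 'k) \<Rightarrow> (nat \<Rightarrow> 'k) \<Rightarrow> real"
    and dEX :: "'p \<Rightarrow> (nat \<Rightarrow> 'x) \<Rightarrow> (nat \<Rightarrow> 'x) \<Rightarrow> real"
    and sEK :: "'p \<Rightarrow> 's \<Rightarrow> (nat \<Rightarrow> 'k) \<Rightarrow> real" and sEX :: "'p \<Rightarrow> 't \<Rightarrow> (nat \<Rightarrow> 'x) \<Rightarrow> real"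
    and GF :: "'q set" and FK :: "'q \<Rightarrow> (nat \<Rightarrow> 'k) set" and FXs :: "'q \<Rightarrow> (nat \<Rightarrow> 'x) set"
    and dFK :: "'q \<Rightarrow> (nat \<Rightarrow> 'k) \<Rightarrow> (nat \<Rightarrow> 'k) \<Rightarrow> real"
    and dFX :: "'q \<Rightarrow> (nat \<Rightarrow> 'x) \<Rightarrow> (nat \<Rightarrow> 'x) \<Rightarrow> real"
    and sFK :: "'q \<Rightarrow> 'u \<Rightarrow> (nat \<Rightarrow> 'k) \<Rightarrow> real" and sFX :: "'q \<Rightarrow> 'v \<Rightarrow> (nat \<Rightarrow> 'x) \<Rightarrow> real"
  assumes X: "kbanach sc" "infinite_dim sc"
    and E: "seq_functor sc GE mE EK dEK sEK EXs dEX sEX"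
    and F: "seq_functor sc GF mF FK dFK sFK FXs dFX sFX"
    and ne: "(\<Inter>p\<in>GE. EK p) - (\<Union>q\<in>GF. FK q) \<noteq> {}"
  shows "\<forall>p\<in>GE. maximal_spaceable (seq_scale sc) (EXs p)
            (functor_top_K mE (EXs p) (dEX p) (sEX p))
            ((\<Inter>r\<in>GE. EXs r) - (\<Union>q\<in>GF. FXs q))"
proof
  fix p assume p: "p \<in> GE"
  interpret kbanach_space sc
    by (rule kbanach_space.intro) (rule X)
  obtain a where a: "\<And>r. r \<in> GE \<Longrightarrow> a \<in> EK r" "\<And>q. q \<in> GF \<Longrightarrow> a \<notin> FK q"
    using ne by blast
  interpret t: Vector_Spaces.linear sc "seq_scale sc" "tensor sc a"
    by (rule linear_tensor)
  have E_lin: "lin_subspace sc (EXs r)" "lin_subspace times (EK r)" if "r \<in> GE" for r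
    using E that unfolding seq_functor_def by blast+
  have E_tensor: "tensor sc b x \<in> EXs r \<longleftrightarrow> b \<in> EK r" if "r \<in> GE" "x \<noteq> 0" for r b x
    using E that unfolding seq_functor_def by blast
  have F_lin: "lin_subspace times (FK q)" if "q \<in> GF" for q
    using F that unfolding seq_functor_def by blast
  have F_tensor: "tensor sc b x \<in> FXs q \<longleftrightarrow> b \<in> FK q" if "q \<in> GF" "x \<noteq> 0" for q b x
    using F that unfolding seq_functor_def by blast
  have "GF \<noteq> {}"
    using F unfolding seq_functor_def by blast
  \<comment> \<open>The zero sequence lies in every \<open>FK q\<close>, and some \<open>q\<close>
    exists.\<close>
  then have "a \<noteq> 0"
    using a(2) F_lin unfolding lin_subspace_def by blast
  \<comment> \<open>Condition (b) concerns nonzero \<open>x\<close>; for \<open>x = 0\<close> the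
    tensor is the zero sequence, which lies in each linear subspace.\<close>
  have mem: "tensor sc a x \<in> EXs r" if "r \<in> GE" for r x
    using E_tensor[OF that] a(1)[OF that] E_lin(1)[OF that] t.zero
    by (cases "x = 0") (auto simp: lin_subspace_def)
  then have sub: "range (tensor sc a) \<subseteq> EXs p"
    using p by blast
  have "range (tensor sc a) \<subseteq> ((\<Inter>r\<in>GE. EXs r) - (\<Union>q\<in>GF. FXs q)) \<union> {0}"
  proof
    fix w assume "w \<in> range (tensor sc a)"
    then obtain x where w: "w = tensor sc a x"
      by blast
    show "w \<in> ((\<Inter>r\<in>GE. EXs r) - (\<Union>q\<in>GF. FXs q)) \<union> {0}"
      using w mem F_tensor a(2) t.zero by (cases "x = 0") auto
  qed
  moreover have "t.vs2.subspace (range (tensor sc a))"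
    using t.subspace_image[OF subspace_UNIV] .
  moreover have "closedin (functor_top_K mE (EXs p) (dEX p) (sEX p)) (range (tensor sc a))"
  proof (cases mE)
    case True
    then have m: "metric_on (EK p) (dEK p)" "metric_on (EXs p) (dEX p)" "translation_invariant (EXs p) (dEX p)"
      and "\<exists>L M. L > 0 \<and> M > 0 \<and> (\<forall>b\<in>EK p. \<forall>x.
        L * norm x * dEK p b 0 \<le> dEX p (tensor sc b x) 0 \<and> dEX p (tensor sc b x) 0 \<le> M * norm x * dEK p b 0)"
      using bspec[OF conjunct2[OF E[unfolded seq_functor_def]] p] X(2) by simp_all
    then obtain L M where LM: "L > 0" "\<forall>b\<in>EK p. \<forall>x.
        L * norm x * dEK p b 0 \<le> dEX p (tensor sc b x) 0 \<and> dEX p (tensor sc b x) 0 \<le> M * norm x * dEK p b 0"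
      by blast
    have "0 \<in> EK p"
      using E_lin(2)[OF p] by (simp add: lin_subspace_def)
    \<comment> \<open>This distance is the constant \<open>D\<close> of the closedness lemma; its
      positivity gives the lower bound its force.\<close>
    then have pos: "dEK p a 0 > 0"
      using m(1) a(1)[OF p] \<open>a \<noteq> 0\<close> unfolding metric_on_def by (metis order_le_less)
    have "closedin (metric_top (EXs p) (dEX p)) (range (tensor sc a))"
      by (rule closedin_range_tensor_metric[OF m(2,3) sub LM(1) pos]) (use LM(2) a(1)[OF p] in auto)
    with True show ?thesis
      by (simp add: functor_top_K_def)
  next
    case False
    then have "\<exists>K i. K > 0 \<and> (\<forall>w\<in>EXs p. \<forall>j. norm (w j) \<le> K * sEX p i w)"
      using bspec[OF conjunct2[OF E[unfolded seq_functor_def]] p] X(2) by simp_all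
    then obtain K i where "K > 0" "\<And>w j. w \<in> EXs p \<Longrightarrow> norm (w j) \<le> K * sEX p i w"
      by blast
    then have "closedin (seminorm_top (EXs p) (sEX p)) (range (tensor sc a))"
      by (intro closedin_range_tensor_seminorm[OF sub E_lin(1)[OF p] \<open>a \<noteq> 0\<close>])
    with False show ?thesis
      by (simp add: functor_top_K_def)
  qed
  moreover obtain B C where "hamel_basis (seq_scale sc) B (range (tensor sc a))"
    "hamel_basis (seq_scale sc) C (EXs p)" "B \<approx> C"
    by (rule hamel_basis_range_tensor_eqpoll[OF X(2) \<open>a \<noteq> 0\<close> E_lin(1)[OF p] sub])
  ultimately show "maximal_spaceable (seq_scale sc) (EXs p)
      (functor_top_K mE (EXs p) (dEX p) (sEX p)) ((\<Inter>r\<in>GE. EXs r) - (\<Union>q\<in>GF. FXs q))"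
    unfolding maximal_spaceable_def using sub by blast
qed

end
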